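(* If $G$ is an Ivanov monster group, then $G$ admits a strongly aperiodic subshift of finite type such that the stabilizer of any of its points is trivial.
   Context: An Ivanov monster group is an infinite finitely generated (simple) group in which every element has finite order and which has only finitely many conjugacy classes. Let $A$ be a finite alphabet. $G$ acts on $A^G$ by $(gx)_h=x_{g^{-1}h}$. A subshift of finite type (SFT) over $G$ is a set $X\subseteq A^G$ for which there is a finite set $L$ of maps $w:D_w\to A$ ($D_w\subseteq G$ finite) such that $X$ is the set of all $x\in A^G$ such that for every $g\in G$ and $w\in L$ the restriction of $gx$ to $D_w$ differs from $w$. The stabilizer of $x$ is $Stab(x)=\{g\in G:gx=x\}$. A subshift $X$ is strongly aperiodic if it is nonempty and $Stab(x)$ is finite for every $x\in X$. "$G$ admits" such an SFT means one exists over some finite alphabet. *)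

theory Defs
  imports "HOL-Algebra.Group_Action" "HOL-Algebra.Generated_Groups"
begin

(* The parenthetical "(simple)" of the informal definition is read as an optional attribute:
   simplicity is not required here, so the simple groups are included as a special case. *)
definition ivanov_monster_group :: "('a, 'm) monoid_scheme \<Rightarrow> bool" where
  "ivanov_monster_group G \<longleftrightarrow>
     group G \<and> infinite (carrier G) \<and>
     (\<exists>S. finite S \<and> S \<subseteq> carrier G \<and> generate G S = carrier G) \<and>
     (\<forall>g\<in>carrier G. \<exists>n::nat. n > 0 \<and> g [^]\<^bsub>G\<^esub> n = \<one>\<^bsub>G\<^esub>) \<and>
     finite (orbits G (carrier G)
       (\<lambda>g. \<lambda>h\<in>carrier G. g \<otimes>\<^bsub>G\<^esub> h \<otimes>\<^bsub>G\<^esub> inv\<^bsub>G\<^esub> g))"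

(* Configurations are the extensional functions carrier G \<rightarrow>\<^sub>E A, so that equality of functions is
   equality of configurations. *)
definition shift_action :: "('a, 'm) monoid_scheme \<Rightarrow> 'a \<Rightarrow> ('a \<Rightarrow> 'c) \<Rightarrow> 'a \<Rightarrow> 'c" where
  "shift_action G g x = (\<lambda>h\<in>carrier G. x (inv\<^bsub>G\<^esub> g \<otimes>\<^bsub>G\<^esub> h))"

(* A pair (D, w) in L is a forbidden pattern w with domain D. *)
definition is_SFT :: "('a, 'm) monoid_scheme \<Rightarrow> 'c set \<Rightarrow> ('a \<Rightarrow> 'c) set \<Rightarrow> bool" where
  "is_SFT G A X \<longleftrightarrow>
     finite A \<and>
     (\<exists>L :: ('a set \<times> ('a \<Rightarrow> 'c)) set.
        finite L \<and>
        (\<forall>(D, w)\<in>L. finite D \<and> D \<subseteq> carrier G \<and> w \<in> D \<rightarrow>\<^sub>E A) \<and>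
        X = {x \<in> carrier G \<rightarrow>\<^sub>E A.
               \<forall>g\<in>carrier G. \<forall>(D, w)\<in>L. restrict (shift_action G g x) D \<noteq> w})"

definition strongly_aperiodic :: "('a, 'm) monoid_scheme \<Rightarrow> ('a \<Rightarrow> 'c) set \<Rightarrow> bool" where
  "strongly_aperiodic G X \<longleftrightarrow>
     X \<noteq> {} \<and> (\<forall>x\<in>X. finite (stabilizer G (shift_action G) x))"

end

theory Submission
  imports Defs
begin

text \<open>Let \<open>K\<close> contain a representative of every nontrivial conjugacy class of \<open>G\<close>. It is a finite set
  without the identity, so the graph on \<open>G\<close> that joins \<open>g\<close> to \<open>g k\<close> for \<open>k \<in> K\<close> has no loops and has
  degree at most \<open>d = card (K \<union> K\<^sup>-\<^sup>1)\<close>. Its proper colourings with colours \<open>{..d}\<close> form the subshift: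

  \<^item> they form an SFT, since a violated edge is seen in the finite window \<open>{1, k}\<close>
    (\<open>proper_colourings_SFT\<close>);

  \<^item> they exist, because a graph of degree at most \<open>d\<close> is greedily coloured with \<open>d + 1\<close> colours along
    a well-order of its vertices (\<open>greedy_colouring\<close>);

  \<^item> they have trivial stabilizers: if \<open>h k h\<^sup>-\<^sup>1\<close> with \<open>k \<in> K\<close> fixed the colouring \<open>x\<close>, then \<open>x\<close> would
    take the same value on the two ends \<open>h\<close> and \<open>h k\<close> of an edge (\<open>proper_colouring_stabilizer\<close>).

  Passing from \<open>k\<close> to all its conjugates costs nothing because the colouring condition is imposed at
  every \<open>h\<close>; this is how finitely many conjugacy classes lead to finitely many forbidden patterns.\<close>

text \<open>Colour each vertex with the least colour not used on its neighbours that precede it in a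
  well-order: there are at most \<open>d\<close> of them, so one of the colours \<open>{..d}\<close> is always free.\<close>

lemma greedy_colouring:
  fixes N :: "'a \<Rightarrow> 'a set" and d :: nat
  assumes sym: "\<And>x y. y \<in> N x \<Longrightarrow> x \<in> N y"
    and irrefl: "\<And>x. x \<notin> N x"
    and fin: "\<And>x. finite (N x)"
    and degree: "\<And>x. card (N x) \<le> d"
  obtains c :: "'a \<Rightarrow> nat" where "\<And>x. c x \<le> d" "\<And>x y. y \<in> N x \<Longrightarrow> c x \<noteq> c y"
proof -
  obtain r :: "'a rel" where r: "Well_order r" "Field r = UNIV"
    using well_ordering[where ?'a = 'a] by auto
  define R where "R = r - Id"
  have wf: "wf R" using r unfolding R_def well_order_on_def by blast
  have total: "(x, y) \<in> R \<or> (y, x) \<in> R" if "x \<noteq> y" for x y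
    using r that unfolding R_def well_order_on_def linear_order_on_def total_on_def by auto
  define P where "P x = {y \<in> N x. (y, x) \<in> R}" for x
  define c :: "'a \<Rightarrow> nat" where
    "c = wfrec R (\<lambda>f x. LEAST k. k \<notin> f ` P x)"
  have c: "c x = (LEAST k. k \<notin> c ` P x)" for x
  proof -
    have "cut c R x ` P x = c ` P x"
      by (rule image_cong) (auto simp: P_def cut_apply)
    moreover have "c x = (LEAST k. k \<notin> cut c R x ` P x)"
      unfolding c_def by (rule wfrec[OF wf])
    ultimately show ?thesis by simp
  qed
  have free: "\<exists>k\<le>d. k \<notin> c ` P x" for x
  proof (rule ccontr)
    assume "\<not> ?thesis"
    then have "{..d} \<subseteq> c ` P x" by blast
    moreover have "finite (P x)" using fin by (simp add: P_def)
    ultimately have "card {..d} \<le> card (P x)"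
      by (meson card_image_le card_mono finite_imageI le_trans)
    also have "\<dots> \<le> card (N x)" by (rule card_mono[OF fin]) (auto simp: P_def)
    finally show False using degree[of x] by simp
  qed
  have unused: "c x \<notin> c ` P x" for x
    using free[of x] unfolding c[of x] by (metis (mono_tags, lifting) LeastI_ex)
  show thesis
  proof
    show "c x \<le> d" for x
      using free[of x] unfolding c[of x] by (meson Least_le le_trans)
    show "c x \<noteq> c y" if y: "y \<in> N x" for x y
    proof -
      have "x \<noteq> y" using y irrefl by blast
      then have "y \<in> P x \<or> x \<in> P y" using total y sym by (auto simp: P_def)
      then show ?thesis using unused by (metis imageI)
    qed
  qed
qed

definition proper_colourings ::
  "('a, 'm) monoid_scheme \<Rightarrow> 'a set \<Rightarrow> 'c set \<Rightarrow> ('a \<Rightarrow> 'c) set" where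
  "proper_colourings G K A =
     {x \<in> carrier G \<rightarrow>\<^sub>E A. \<forall>g\<in>carrier G. \<forall>k\<in>K. x g \<noteq> x (g \<otimes>\<^bsub>G\<^esub> k)}"

context group
begin

text \<open>Translating the edge between \<open>g\<close> and \<open>g k\<close> to the identity moves it to the window \<open>{1, k}\<close>, so
  the forbidden patterns are the constant ones on these windows.\<close>

lemma proper_colourings_SFT:
  assumes K: "finite K" "K \<subseteq> carrier G" and A: "finite A"
  shows "is_SFT G A (proper_colourings G K A)"
proof -
  define L where "L = (\<lambda>(k, a). ({\<one>, k}, \<lambda>_\<in>{\<one>, k}. a)) ` (K \<times> A)"
  have pattern: "restrict (shift_action G g x) {\<one>, k} = (\<lambda>_\<in>{\<one>, k}. a)
      \<longleftrightarrow> x (inv g) = a \<and> x (inv g \<otimes> k) = a"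
    if "g \<in> carrier G" "k \<in> K" for g k x a
    using that K by (auto simp: fun_eq_iff restrict_def shift_action_def)
  have "(\<forall>g\<in>carrier G. \<forall>(D, w)\<in>L. restrict (shift_action G g x) D \<noteq> w)
      \<longleftrightarrow> (\<forall>g\<in>carrier G. \<forall>k\<in>K. x g \<noteq> x (g \<otimes> k))" (is "?avoids \<longleftrightarrow> ?proper")
    if x: "x \<in> carrier G \<rightarrow>\<^sub>E A" for x
  proof -
    have "?avoids \<longleftrightarrow>
        (\<forall>g\<in>carrier G. \<forall>k\<in>K. \<forall>a\<in>A. \<not> (x (inv g) = a \<and> x (inv g \<otimes> k) = a))"
      by (auto simp: L_def pattern)
    also have "\<dots> \<longleftrightarrow> (\<forall>g\<in>carrier G. \<forall>k\<in>K. x (inv g) \<noteq> x (inv g \<otimes> k))"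
      using x by (metis PiE_mem inv_closed)
    also have "\<dots> \<longleftrightarrow> ?proper"
      by (metis inv_closed inv_inv)
    finally show ?thesis .
  qed
  then have "proper_colourings G K A = {x \<in> carrier G \<rightarrow>\<^sub>E A.
      \<forall>g\<in>carrier G. \<forall>(D, w)\<in>L. restrict (shift_action G g x) D \<noteq> w}"
    unfolding proper_colourings_def by (intro Collect_cong conj_cong) simp_all
  moreover have "finite L" using K A by (simp add: L_def)
  moreover have "\<forall>(D, w)\<in>L. finite D \<and> D \<subseteq> carrier G \<and> w \<in> D \<rightarrow>\<^sub>E A"
    using K by (auto simp: L_def)
  ultimately show ?thesis
    unfolding is_SFT_def using A by blast
qed

text \<open>An edge from \<open>g\<close> to \<open>g k\<close> runs back along \<open>k\<^sup>-\<^sup>1\<close>, so the neighbours of \<open>g\<close> are its right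
  translates by \<open>K \<union> K\<^sup>-\<^sup>1\<close>. The bound on their number does not depend on \<open>g\<close>, which gives a finite
  palette; \<open>\<one> \<notin> K\<close> excludes loops.\<close>

lemma proper_colourings_nonempty:
  assumes K: "finite K" "K \<subseteq> carrier G - {\<one>}"
  obtains d :: nat where "proper_colourings G K {..d} \<noteq> {}"
proof -
  define K' where "K' = K \<union> m_inv G ` K"
  have K': "finite K'" "K' \<subseteq> carrier G" "\<one> \<notin> K'" "\<And>k. k \<in> K' \<Longrightarrow> inv k \<in> K'"
    using K by (auto simp: K'_def subset_iff inv_eq_1_iff eq_commute[of \<one>])
  \<comment> \<open>The relation must be symmetric on the whole type, so elements outside the group are isolated.\<close>
  define N where "N g = (if g \<in> carrier G then (\<otimes>) g ` K' else {})" for g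
  obtain c :: "'a \<Rightarrow> nat"
    where c: "\<And>g. c g \<le> card K'" "\<And>g h. h \<in> N g \<Longrightarrow> c g \<noteq> c h"
  proof (rule greedy_colouring[of N "card K'"])
    show "g \<in> N h" if h: "h \<in> N g" for g h
    proof -
      obtain k where k: "k \<in> K'" "h = g \<otimes> k" and g: "g \<in> carrier G"
        using h by (auto simp: N_def split: if_splits)
      then have "g = h \<otimes> inv k" "h \<in> carrier G" using K' by (auto simp: m_assoc subset_iff)
      then show ?thesis using k K' by (auto simp: N_def)
    qed
    show "g \<notin> N g" for g
    proof
      assume "g \<in> N g"
      then obtain k where k: "k \<in> K'" "g = g \<otimes> k" and g: "g \<in> carrier G"
        by (auto simp: N_def split: if_splits)
      have "k = \<one>" using l_cancel_one'[of g k] k g K'(2) by blast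
      then show False using k K'(3) by simp
    qed
    show "finite (N g)" "card (N g) \<le> card K'" for g
      using K' by (auto simp: N_def card_image_le)
  qed blast
  have "restrict c (carrier G) \<in> proper_colourings G K {..card K'}"
  proof -
    have "g \<otimes> k \<in> N g" if "g \<in> carrier G" "k \<in> K" for g k
      using that by (auto simp: N_def K'_def)
    then have "c g \<noteq> c (g \<otimes> k)" if "g \<in> carrier G" "k \<in> K" for g k
      using that c(2) by blast
    moreover have "K \<subseteq> carrier G" using K by blast
    ultimately show ?thesis
      using c(1) by (simp add: proper_colourings_def subset_iff)
  qed
  then show thesis using that by blast
qed

text \<open>If \<open>g = h k h\<^sup>-\<^sup>1\<close> fixes \<open>x\<close>, then \<open>x\<close> is invariant under left translation by \<open>g\<close>; but
  \<open>g h = h k\<close>, so left translation by \<open>g\<close> moves \<open>h\<close> along an edge, where a proper colouring must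
  change its value.\<close>

lemma proper_colouring_stabilizer:
  assumes K: "K \<subseteq> carrier G"
    and reps: "\<And>g. g \<in> carrier G \<Longrightarrow> g \<noteq> \<one> \<Longrightarrow> \<exists>h\<in>carrier G. \<exists>k\<in>K. g = h \<otimes> k \<otimes> inv h"
    and x: "x \<in> proper_colourings G K A"
  shows "stabilizer G (shift_action G) x = {\<one>}"
proof
  have "shift_action G \<one> x = x"
    using x by (auto simp: proper_colourings_def shift_action_def fun_eq_iff PiE_def extensional_def)
  then show "{\<one>} \<subseteq> stabilizer G (shift_action G) x" by (simp add: stabilizer_def)
  show "stabilizer G (shift_action G) x \<subseteq> {\<one>}"
  proof (rule subsetI, rule ccontr)
    fix g assume "g \<in> stabilizer G (shift_action G) x" "g \<notin> {\<one>}"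
    then have g: "g \<in> carrier G" "shift_action G g x = x" "g \<noteq> \<one>"
      by (auto simp: stabilizer_def)
    then obtain h k where hk: "h \<in> carrier G" "k \<in> K" "k \<in> carrier G" "g = h \<otimes> k \<otimes> inv h"
      using reps K by blast
    have gh: "h \<otimes> k = g \<otimes> h" using hk by (simp add: m_assoc)
    have "x (h \<otimes> k) = shift_action G g x (g \<otimes> h)" using g gh by simp
    also have "\<dots> = x (inv g \<otimes> (g \<otimes> h))" using g(1) hk(1) by (simp add: shift_action_def)
    also have "\<dots> = x h" using g(1) hk(1) by (simp add: m_assoc[symmetric])
    finally have "x (h \<otimes> k) = x h" .
    moreover have "x h \<noteq> x (h \<otimes> k)"
      using x hk(1,2) unfolding proper_colourings_def by blast
    ultimately show False by simp
  qed
qed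

lemma conjugacy_representatives:
  assumes "finite (orbits G (carrier G) (\<lambda>g. \<lambda>h\<in>carrier G. g \<otimes> h \<otimes> inv g))"
    (is "finite (orbits G (carrier G) ?conj)")
  obtains K where "finite K" "K \<subseteq> carrier G - {\<one>}"
    "\<And>g. g \<in> carrier G \<Longrightarrow> g \<noteq> \<one> \<Longrightarrow> \<exists>h\<in>carrier G. \<exists>k\<in>K. g = h \<otimes> k \<otimes> inv h"
proof
  define rep where "rep C = (SOME k. k \<in> C)" for C :: "'a set"
  define K where "K = rep ` orbits G (carrier G) ?conj - {\<one>}"
  have rep: "\<exists>a\<in>carrier G. rep (orbit G ?conj g) = a \<otimes> g \<otimes> inv a" if g: "g \<in> carrier G" for g
  proof -
    have "?conj \<one> g \<in> orbit G ?conj g" unfolding orbit_def by blast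
    then have "rep (orbit G ?conj g) \<in> orbit G ?conj g" unfolding rep_def by (rule someI)
    then show ?thesis using g by (auto simp: orbit_def)
  qed
  show "finite K" using assms by (simp add: K_def)
  show "K \<subseteq> carrier G - {\<one>}" using rep by (fastforce simp: K_def orbits_def)
  show "\<exists>h\<in>carrier G. \<exists>k\<in>K. g = h \<otimes> k \<otimes> inv h" if g: "g \<in> carrier G" "g \<noteq> \<one>" for g
  proof -
    obtain a where a: "a \<in> carrier G" "rep (orbit G ?conj g) = a \<otimes> g \<otimes> inv a"
      using rep g by blast
    have eq: "g = inv a \<otimes> (a \<otimes> g \<otimes> inv a) \<otimes> inv (inv a)"
      using a g by (simp add: m_assoc) (simp add: m_assoc[symmetric])
    have "a \<otimes> g \<otimes> inv a \<noteq> \<one>" using eq a g by auto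
    then have "a \<otimes> g \<otimes> inv a \<in> K"
      using a g by (auto simp: K_def orbits_def image_iff intro!: exI[of _ "orbit G ?conj g"])
    then show ?thesis using eq a by blast
  qed
qed

end

theorem proposition4p4:
  fixes G :: "('a, 'm) monoid_scheme"
  assumes "ivanov_monster_group G"
  shows "\<exists>(A :: nat set) (X :: ('a \<Rightarrow> nat) set).
           is_SFT G A X \<and> strongly_aperiodic G X \<and>
           (\<forall>x\<in>X. stabilizer G (shift_action G) x = {\<one>\<^bsub>G\<^esub>})"
proof -
  interpret group G using assms by (simp add: ivanov_monster_group_def)
  obtain K where K: "finite K" "K \<subseteq> carrier G - {\<one>\<^bsub>G\<^esub>}"
    and reps: "\<And>g. g \<in> carrier G \<Longrightarrow> g \<noteq> \<one>\<^bsub>G\<^esub> \<Longrightarrow>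
      \<exists>h\<in>carrier G. \<exists>k\<in>K. g = h \<otimes>\<^bsub>G\<^esub> k \<otimes>\<^bsub>G\<^esub> inv\<^bsub>G\<^esub> h"
    using conjugacy_representatives assms unfolding ivanov_monster_group_def by blast
  obtain d :: nat where "proper_colourings G K {..d} \<noteq> {}"
    using proper_colourings_nonempty[OF K] by blast
  moreover have "is_SFT G {..d} (proper_colourings G K {..d})"
    using proper_colourings_SFT K by blast
  moreover have "\<forall>x\<in>proper_colourings G K {..d}. stabilizer G (shift_action G) x = {\<one>\<^bsub>G\<^esub>}"
    using proper_colouring_stabilizer[OF _ reps] K by blast
  ultimately show ?thesis
    unfolding strongly_aperiodic_def by (metis finite.emptyI finite.insertI)
qed

end
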